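(* Fix constants $c_1,\dots,c_N\ge 0$. For each $M\ge1$ let $\mathbf{a}^{(M)}\in\mathbb{C}^N$ be any gain vector with $|a_i^{(M)}|^2=c_i/M$ for all $i$, and let $\mathbf{H}_M$ be the $M\times N$ channel matrix. Then, almost surely, $$\lim_{M\to\infty} g_{\mathbf{H}_M}(\mathbf{a}^{(M)})=\sum_{i=1}^N\frac{c_i}{\sigma_n^2 d_i^{\alpha}+\sigma_{v,i}^2 c_i}.$$ Consequently, for fixed $\epsilon\in(0,1]$, the probability of detection at false-alarm level $\epsilon$, namely $\epsilon^{1/(1+\sigma_\theta^2 g_{\mathbf{H}_M}(\mathbf{a}^{(M)}))}$, converges almost surely to the constant $\epsilon^{1/(1+\sigma_\theta^2\sum_i c_i/(\sigma_n^2 d_i^\alpha+\sigma_{v,i}^2c_i))}$; i.e. reducing every $|a_i|^2$ by a factor $1/M$ as $M\to\infty$ asymptotically preserves detection performance.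
   Context: Constants: $\sigma_\theta^2,\sigma_n^2>0$, $\sigma_{v,i}^2>0$, distances $d_i>0$, path-loss exponent $\alpha>0$, $i=1,\dots,N$. Channel model: let $(\tilde h_{mi})_{m\ge1,\,1\le i\le N}$ be i.i.d. $\mathcal{CN}(0,1)$ random variables, and let $\mathbf{H}_M\in\mathbb{C}^{M\times N}$ have entries $[\mathbf{H}_M]_{mi}=\tilde h_{mi}/\sqrt{d_i^{\alpha}}$, $m\le M$. For $\mathbf{a}\in\mathbb{C}^N$, $\mathbf{D}=\mathrm{diag}\{a_1,\dots,a_N\}$, $\mathbf{V}=\mathrm{diag}\{\sigma_{v,1}^2,\dots,\sigma_{v,N}^2\}$, and $$g_{\mathbf{H}}(\mathbf{a})=\mathbf{a}^H\mathbf{H}^H\big(\mathbf{H}\mathbf{D}\mathbf{V}\mathbf{D}^H\mathbf{H}^H+\sigma_n^2\mathbf{I}_M\big)^{-1}\mathbf{H}\mathbf{a}.$$ (This $g$ is the quantity governing the Neyman–Pearson detector for the model $\mathcal{H}_0:\mathbf{y}=\mathbf{H}\mathbf{D}\mathbf{v}+\mathbf{n}$, $\mathcal{H}_1:\mathbf{y}=\mathbf{H}\mathbf{a}\theta+\mathbf{H}\mathbf{D}\mathbf{v}+\mathbf{n}$ with $\theta\sim\mathcal{CN}(0,\sigma_\theta^2)$, $\mathbf{v}\sim\mathcal{CN}(\mathbf{0},\mathbf{V})$, $\mathbf{n}\sim\mathcal{CN}(\mathbf{0},\sigma_n^2\mathbf{I}_M)$ independent, whose detection probability at false-alarm probability $\epsilon$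 equals $\epsilon^{1/(1+\sigma_\theta^2 g)}$.) *)

theory Defs
  imports "HOL-Probability.Probability"
    "Jordan_Normal_Form.Schur_Decomposition"
    "Jordan_Normal_Form.Gauss_Jordan_Elimination"
begin

definition diag_of :: "nat \<Rightarrow> (nat \<Rightarrow> complex) \<Rightarrow> complex mat" where
  "diag_of n x = mat n n (\<lambda>(i,j). if i = j then x i else 0)"

text \<open>Channel matrix H_M (M x N) built from the i.i.d. CN(0,1) entries h m i:
  [H_M]_{mi} = h_{mi} / sqrt(d_i^alpha).\<close>
definition chan_mat :: "nat \<Rightarrow> nat \<Rightarrow> (nat \<Rightarrow> real) \<Rightarrow> real \<Rightarrow> (nat \<Rightarrow> nat \<Rightarrow> complex) \<Rightarrow> complex mat" where
  "chan_mat M N d alpha h = mat M N (\<lambda>(m,i). h m i / complex_of_real (sqrt (d i powr alpha)))"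

text \<open>g_H(a) = a^H H^H (H D V D^H H^H + sigma_n^2 I_M)^{-1} H a,
  with D = diag(a), V = diag(sigma_{v,i}^2); sv2 i = sigma_{v,i}^2, sn2 = sigma_n^2.\<close>
definition g_fun :: "nat \<Rightarrow> real \<Rightarrow> (nat \<Rightarrow> real) \<Rightarrow> complex mat \<Rightarrow> complex vec \<Rightarrow> complex" where
  "g_fun N sn2 sv2 H a =
    (let Mr = dim_row H;
         D = diag_of N (\<lambda>i. a $ i);
         V = diag_of N (\<lambda>i. complex_of_real (sv2 i));
         X = H * D * V * mat_adjoint D * mat_adjoint H + complex_of_real sn2 \<cdot>\<^sub>m 1\<^sub>m Mr
     in scalar_prod (conjugate a) (mat_adjoint H *\<^sub>v (the (mat_inverse X) *\<^sub>v (H *\<^sub>v a))))"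

end

theory Submission
  imports Defs "HOL-Library.Discrete_Functions"
begin

text \<open>
  Put \<open>B = H D\<close>, \<open>X = B V B\<^sup>H + s I\<close> and \<open>y = B\<^sup>H X\<^sup>-\<^sup>1 B 1\<close>, so that \<open>g\<close> is the sum of the entries of \<open>y\<close>.
  With the Gram matrix \<open>G = B\<^sup>H B\<close>, multiplying \<open>X x = B 1\<close> by \<open>B\<^sup>H\<close> gives the \<open>N \<times> N\<close> system
  \<open>(G V + s I) y = G 1\<close>, while pairing it with \<open>x\<close> bounds \<open>y\<close> independently of \<open>M\<close>. Hence only the limit of \<open>G\<close>
  matters, and by a strong law of large numbers \<open>G\<close> converges almost surely to the diagonal matrix with entries
  \<open>c\<^sub>i / d\<^sub>i powr alpha\<close>. The strong law needs only orthogonality and bounded second moments: convergence holds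
  along the squares \<open>k\<^sup>2\<close>, and the oscillation between consecutive squares is summable in mean square.
\<close>

no_notation scalar_prod (infix "\<bullet>" 70)

section \<open>A strong law of large numbers for orthogonal sequences\<close>

lemma integrable_inner_of_square:
  fixes f g :: "'a \<Rightarrow> 'b::euclidean_space"
  assumes [measurable]: "f \<in> borel_measurable M" "g \<in> borel_measurable M"
    and "integrable M (\<lambda>x. (norm (f x))\<^sup>2)" "integrable M (\<lambda>x. (norm (g x))\<^sup>2)"
  shows "integrable M (\<lambda>x. f x \<bullet> g x)"
proof (rule Bochner_Integration.integrable_bound)
  show "integrable M (\<lambda>x. (norm (f x))\<^sup>2 + (norm (g x))\<^sup>2)"
    using assms by simp
  show "AE x in M. norm (f x \<bullet> g x) \<le> norm ((norm (f x))\<^sup>2 + (norm (g x))\<^sup>2)"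
  proof (rule AE_I2)
    fix x
    have "\<bar>f x \<bullet> g x\<bar> \<le> norm (f x) * norm (g x)" by (rule Cauchy_Schwarz_ineq2)
    also have "\<dots> \<le> (norm (f x))\<^sup>2 + (norm (g x))\<^sup>2"
      using sum_squares_bound[of "norm (f x)" "norm (g x)"]
        mult_nonneg_nonneg[OF norm_ge_zero[of "f x"] norm_ge_zero[of "g x"]] by linarith
    finally show "norm (f x \<bullet> g x) \<le> norm ((norm (f x))\<^sup>2 + (norm (g x))\<^sup>2)" by simp
  qed
qed simp

text \<open>Pythagoras in L2: the squared norm expands into a double sum of inner products, and
  every off-diagonal integral vanishes by \<open>orth\<close>. Cauchy-Schwarz makes each cross term
  integrable, so the integral may be taken termwise.\<close>

lemma orthogonal_sum_square:
  fixes X :: "nat \<Rightarrow> 'a \<Rightarrow> 'b::euclidean_space"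
  assumes [measurable]: "\<And>n. X n \<in> borel_measurable M"
    and sq: "\<And>n. integrable M (\<lambda>x. (norm (X n x))\<^sup>2)"
    and orth: "\<And>m n. m \<noteq> n \<Longrightarrow> (LINT x|M. X m x \<bullet> X n x) = 0"
    and "finite I"
  shows "integrable M (\<lambda>x. (norm (\<Sum>i\<in>I. X i x))\<^sup>2)"
    and "(LINT x|M. (norm (\<Sum>i\<in>I. X i x))\<^sup>2) = (\<Sum>i\<in>I. LINT x|M. (norm (X i x))\<^sup>2)"
proof -
  have expand: "(norm (\<Sum>i\<in>I. X i x))\<^sup>2 = (\<Sum>i\<in>I. \<Sum>j\<in>I. X i x \<bullet> X j x)" for x
    unfolding power2_norm_eq_inner inner_sum_left by (simp only: inner_sum_right)
  have int: "integrable M (\<lambda>x. X i x \<bullet> X j x)" for i j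
    by (intro integrable_inner_of_square sq) simp_all
  show "integrable M (\<lambda>x. (norm (\<Sum>i\<in>I. X i x))\<^sup>2)"
    unfolding expand by (intro Bochner_Integration.integrable_sum int)
  have "(LINT x|M. (norm (\<Sum>i\<in>I. X i x))\<^sup>2) = (\<Sum>i\<in>I. \<Sum>j\<in>I. LINT x|M. X i x \<bullet> X j x)"
    unfolding expand by (simp add: Bochner_Integration.integral_sum int)
  also have "\<dots> = (\<Sum>i\<in>I. \<Sum>j\<in>I. if j = i then LINT x|M. (norm (X i x))\<^sup>2 else 0)"
    by (intro sum.cong refl) (auto simp: orth power2_norm_eq_inner)
  finally show "(LINT x|M. (norm (\<Sum>i\<in>I. X i x))\<^sup>2) = (\<Sum>i\<in>I. LINT x|M. (norm (X i x))\<^sup>2)"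
    using \<open>finite I\<close> by simp
qed

text \<open>The integral of the series equals the series of the integrals, which is finite. Hence
  the series converges almost everywhere and its terms tend to zero there. This plays the part of
  Borel-Cantelli in the strong law below.\<close>

lemma AE_tendsto_zero_of_summable_integrals:
  fixes f :: "nat \<Rightarrow> 'a \<Rightarrow> real"
  assumes int: "\<And>k. integrable M (f k)" and nn: "\<And>k x. 0 \<le> f k x"
    and sm: "summable (\<lambda>k. LINT x|M. f k x)"
  shows "AE x in M. (\<lambda>k. f k x) \<longlonglongrightarrow> 0"
proof -
  have [measurable]: "f k \<in> borel_measurable M" for k using int by blast
  have "(\<integral>\<^sup>+x. (\<Sum>k. ennreal (f k x)) \<partial>M) = (\<Sum>k. \<integral>\<^sup>+x. ennreal (f k x) \<partial>M)"
    by (rule nn_integral_suminf) simp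
  also have "\<dots> = (\<Sum>k. ennreal (LINT x|M. f k x))"
    by (simp add: nn_integral_eq_integral int nn)
  also have "\<dots> = ennreal (\<Sum>k. LINT x|M. f k x)"
    using sm by (intro suminf_ennreal2) (simp_all add: nn)
  finally have "AE x in M. (\<Sum>k. ennreal (f k x)) \<noteq> \<infinity>"
    by (intro nn_integral_PInf_AE) simp_all
  then show ?thesis
  proof eventually_elim
    case (elim x)
    then have "summable (\<lambda>k. f k x)"
      by (intro summable_suminf_not_top) (simp_all add: nn top_ennreal_def[symmetric] infinity_ennreal_def)
    then show ?case by (rule summable_LIMSEQ_zero)
  qed
qed

text \<open>The deterministic half of the strong law. For \<open>k = floor_sqrt n\<close>,
  \<open>S n\<close> is \<open>S (k\<^sup>2)\<close> plus an oscillation inside the block between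
  consecutive squares, and \<open>real k ^ 4 \<le> (real n)\<^sup>2\<close>. Summing the squared
  oscillations over the block, instead of taking their maximum, keeps the expression easy to
  integrate.\<close>

lemma averages_tendsto_zero_of_square_blocks:
  fixes S :: "nat \<Rightarrow> 'b::real_normed_vector"
  assumes T: "(\<lambda>k. ((norm (S (k\<^sup>2)))\<^sup>2 + (\<Sum>n\<in>{k\<^sup>2..<(Suc k)\<^sup>2}. (norm (S n - S (k\<^sup>2)))\<^sup>2)) / real k ^ 4) \<longlonglongrightarrow> 0"
  shows "(\<lambda>n. S n /\<^sub>R real n) \<longlonglongrightarrow> 0"
proof -
  define T where "T k = ((norm (S (k\<^sup>2)))\<^sup>2 + (\<Sum>n\<in>{k\<^sup>2..<(Suc k)\<^sup>2}. (norm (S n - S (k\<^sup>2)))\<^sup>2)) / real k ^ 4" for k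
  have lim: "filterlim floor_sqrt at_top sequentially"
    unfolding filterlim_at_top_ge[where c=0]
  proof (intro allI impI)
    fix Z :: nat
    show "eventually (\<lambda>n. Z \<le> floor_sqrt n) sequentially"
      using eventually_ge_at_top[of "Z\<^sup>2"]
      by eventually_elim (metis floor_sqrt_inverse_power2 mono_floor_sqrt')
  qed
  have bound: "(norm (S n /\<^sub>R real n))\<^sup>2 \<le> 2 * T (floor_sqrt n)" if n: "n > 0" for n
  proof -
    define k where "k = floor_sqrt n"
    have k: "k > 0" "k\<^sup>2 \<le> n" "n < (Suc k)\<^sup>2"
      using n floor_sqrt_power2_le[of n] Suc_floor_sqrt_power2_gt[of n] by (auto simp: k_def)
    have kn: "real k ^ 4 \<le> (real n)\<^sup>2"
    proof -
      have "(real (k\<^sup>2))\<^sup>2 \<le> (real n)\<^sup>2" using k(2) by (intro power_mono) (simp_all only: of_nat_le_iff of_nat_0_le_iff)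
      then show ?thesis by (simp add: power_mult[symmetric])
    qed
    have "(norm (S n))\<^sup>2 \<le> (norm (S (k\<^sup>2)) + norm (S n - S (k\<^sup>2)))\<^sup>2"
      by (intro power_mono) (use norm_triangle_ineq[of "S (k\<^sup>2)" "S n - S (k\<^sup>2)"] in simp_all)
    also have "\<dots> \<le> 2 * ((norm (S (k\<^sup>2)))\<^sup>2 + (norm (S n - S (k\<^sup>2)))\<^sup>2)"
      using sum_squares_bound[of "norm (S (k\<^sup>2))" "norm (S n - S (k\<^sup>2))"] by (simp add: power2_sum)
    \<comment> \<open>The one oscillation belonging to \<open>n\<close> is a term of the sum over
      the whole block, since \<open>n\<close> lies between \<open>k\<^sup>2\<close> and
      \<open>(Suc k)\<^sup>2\<close>.\<close>
    also have "\<dots> \<le> 2 * ((norm (S (k\<^sup>2)))\<^sup>2 + (\<Sum>n\<in>{k\<^sup>2..<(Suc k)\<^sup>2}. (norm (S n - S (k\<^sup>2)))\<^sup>2))"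
      using k by (intro mult_left_mono add_left_mono member_le_sum) auto
    also have "\<dots> = 2 * T k * real k ^ 4"
      using k(1) by (simp add: T_def)
    also have "\<dots> \<le> 2 * T k * (real n)\<^sup>2"
      by (intro mult_left_mono kn) (simp add: T_def sum_nonneg)
    finally show ?thesis
      using n by (simp add: k_def power_divide divide_simps power_mult_distrib)
  qed
  have "(\<lambda>n. (norm (S n /\<^sub>R real n))\<^sup>2) \<longlonglongrightarrow> 0"
  proof (rule tendsto_sandwich[OF _ _ tendsto_const])
    show "eventually (\<lambda>n. (norm (S n /\<^sub>R real n))\<^sup>2 \<le> 2 * T (floor_sqrt n)) sequentially"
      using eventually_gt_at_top[of 0] by eventually_elim (rule bound)
    have "(\<lambda>n. T (floor_sqrt n)) \<longlonglongrightarrow> 0"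
      using filterlim_compose[OF T lim] by (simp add: T_def)
    then show "(\<lambda>n. 2 * T (floor_sqrt n)) \<longlonglongrightarrow> 0" by (intro tendsto_mult_right_zero)
  qed simp
  then have "(\<lambda>n. sqrt ((norm (S n /\<^sub>R real n))\<^sup>2)) \<longlonglongrightarrow> sqrt 0" by (rule tendsto_real_sqrt)
  then have "(\<lambda>n. norm (S n /\<^sub>R real n)) \<longlonglongrightarrow> 0" unfolding real_sqrt_abs abs_norm_cancel by simp
  then show ?thesis by (rule tendsto_norm_zero_cancel)
qed

text \<open>By orthogonality the mean square of a sum of \<open>n\<close> terms is at most
  \<open>n * C\<close>. A block contains \<open>2 * k + 1\<close> indices, each contributing at most
  \<open>(2 * k + 1) * C\<close>, so after division by \<open>real k ^ 4\<close> the mean of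
  \<open>T k\<close> is of order \<open>1 / k\<^sup>2\<close>. These means are summable, hence
  \<open>T k\<close> tends to zero almost everywhere.\<close>

lemma strong_law_orthogonal:
  fixes X :: "nat \<Rightarrow> 'a \<Rightarrow> 'b::euclidean_space"
  assumes [measurable]: "\<And>n. X n \<in> borel_measurable M"
    and sq: "\<And>n. integrable M (\<lambda>x. (norm (X n x))\<^sup>2)"
    and orth: "\<And>m n. m \<noteq> n \<Longrightarrow> (LINT x|M. X m x \<bullet> X n x) = 0"
    and C: "\<And>n. (LINT x|M. (norm (X n x))\<^sup>2) \<le> C"
  shows "AE x in M. (\<lambda>n. (\<Sum>i<n. X i x) /\<^sub>R real n) \<longlonglongrightarrow> 0"
proof -
  define S where "S n x = (\<Sum>i<n. X i x)" for n x
  define T where "T k x = ((norm (S (k\<^sup>2) x))\<^sup>2 + (\<Sum>n\<in>{k\<^sup>2..<(Suc k)\<^sup>2}. (norm (S n x - S (k\<^sup>2) x))\<^sup>2)) / real k ^ 4" for k x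
  have C0: "0 \<le> C" using C[of 0] by (rule order_trans[rotated]) simp
  note sum_sq = orthogonal_sum_square[of X M, OF assms(1) sq orth]
  have diff: "S n x - S m x = (\<Sum>i\<in>{m..<n}. X i x)" if "m \<le> n" for m n x
    using that sum_diff[of "{..<n}" "{..<m}" "\<lambda>i. X i x"] 
    by (auto simp: S_def lessThan_minus_lessThan)
  have bd: "integrable M (\<lambda>x. (norm (S n x - S m x))\<^sup>2)"
       "(LINT x|M. (norm (S n x - S m x))\<^sup>2) \<le> real (n - m) * C" if "m \<le> n" for m n
  proof -
    show "integrable M (\<lambda>x. (norm (S n x - S m x))\<^sup>2)"
      unfolding diff[OF that] by (rule sum_sq) simp_all
    have "(LINT x|M. (norm (S n x - S m x))\<^sup>2) = (\<Sum>i\<in>{m..<n}. LINT x|M. (norm (X i x))\<^sup>2)"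
      unfolding diff[OF that] by (rule sum_sq) simp_all
    also have "\<dots> \<le> (\<Sum>i\<in>{m..<n}. C)" by (intro sum_mono C)
    finally show "(LINT x|M. (norm (S n x - S m x))\<^sup>2) \<le> real (n - m) * C" by simp
  qed
  have bd0: "integrable M (\<lambda>x. (norm (S n x))\<^sup>2)" "(LINT x|M. (norm (S n x))\<^sup>2) \<le> real n * C" for n
    using bd[of 0 n] by (simp_all add: S_def)
  have intT: "integrable M (T k)" for k
    unfolding T_def using bd bd0 by (intro integrable_divide Bochner_Integration.integrable_add Bochner_Integration.integrable_sum) auto
  have T0: "0 \<le> T k x" for k x by (simp add: T_def sum_nonneg)
  \<comment> \<open>For \<open>k \<ge> 1\<close> the constant 10 is 1 + 9, from
    \<open>(2 * k + 1)\<^sup>2 \<le> (3 * k)\<^sup>2\<close>. For \<open>k = 0\<close> both sides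
    are 0, because division by zero yields 0.\<close>
  have boundT: "(LINT x|M. T k x) \<le> 10 * C * (1 / real k ^ 2)" for k
  proof (cases "k = 0")
    case False
    have "(LINT x|M. T k x) = ((LINT x|M. (norm (S (k\<^sup>2) x))\<^sup>2)
        + (\<Sum>n\<in>{k\<^sup>2..<(Suc k)\<^sup>2}. LINT x|M. (norm (S n x - S (k\<^sup>2) x))\<^sup>2)) / real k ^ 4"
      unfolding T_def integral_divide_zero
      by (subst Bochner_Integration.integral_add, (intro bd0 Bochner_Integration.integrable_sum bd; simp)+,
          subst Bochner_Integration.integral_sum) (auto intro: bd)
    also have "\<dots> \<le> (real (k\<^sup>2) * C + (\<Sum>n\<in>{k\<^sup>2..<(Suc k)\<^sup>2}. real (2 * k + 1) * C)) / real k ^ 4"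
    proof (intro divide_right_mono add_mono sum_mono bd0)
      fix n assume n: "n \<in> {k\<^sup>2..<(Suc k)\<^sup>2}"
      then have "(LINT x|M. (norm (S n x - S (k\<^sup>2) x))\<^sup>2) \<le> real (n - k\<^sup>2) * C"
        by (intro bd) simp
      also have "\<dots> \<le> real (2 * k + 1) * C"
        using n by (intro mult_right_mono C0 of_nat_mono) (auto simp: power2_eq_square)
      finally show "(LINT x|M. (norm (S n x - S (k\<^sup>2) x))\<^sup>2) \<le> real (2 * k + 1) * C" .
    qed simp
    also have "\<dots> = ((real k)\<^sup>2 + (2 * real k + 1)\<^sup>2) * C / real k ^ 4"
    proof -
      have "(Suc k)\<^sup>2 - k\<^sup>2 = 2 * k + 1" by (simp add: power2_eq_square)
      then show ?thesis by (simp add: algebra_simps power2_eq_square)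
    qed
    also have "\<dots> \<le> (10 * (real k)\<^sup>2) * C / real k ^ 4"
    proof (intro divide_right_mono mult_right_mono C0)
      have "(2 * real k + 1)\<^sup>2 \<le> (3 * real k)\<^sup>2" using False by (intro power_mono) auto
      then show "(real k)\<^sup>2 + (2 * real k + 1)\<^sup>2 \<le> 10 * (real k)\<^sup>2" by (simp add: power_mult_distrib)
    qed simp
    also have "\<dots> = 10 * C * (1 / real k ^ 2)"
      using False by (simp add: divide_simps power2_eq_square power4_eq_xxxx)
    finally show ?thesis .
  qed (simp add: T_def)
  have "summable (\<lambda>k. LINT x|M. T k x)"
  proof (rule summable_comparison_test')
    show "summable (\<lambda>k. 10 * C * (1 / real k ^ 2))"
      by (intro summable_mult) (use inverse_power_summable[of 2, where 'a=real] in \<open>simp add: inverse_eq_divide\<close>)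
    show "norm (LINT x|M. T k x) \<le> 10 * C * (1 / real k ^ 2)" for k
      using boundT[of k] T0 by simp
  qed
  then have "AE x in M. (\<lambda>k. T k x) \<longlonglongrightarrow> 0"
    by (rule AE_tendsto_zero_of_summable_integrals[OF intT T0])
  then show ?thesis
  proof eventually_elim
    case (elim x)
    then show ?case
      using averages_tendsto_zero_of_square_blocks[of "\<lambda>n. S n x"] by (simp add: T_def S_def)
  qed
qed

section \<open>Complex Gaussian moments and empirical Gram matrices\<close>

text \<open>The standard complex Gaussian density is the product of two centred real normal
  densities of variance 1/2, one in each coordinate, and Lebesgue measure on the plane is the
  product of the coordinate measures. Integrating out the other coordinate leaves the
  marginal.\<close>

lemma distributed_complex_gaussian_component:
  fixes Z :: "'w \<Rightarrow> complex" and b :: complex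
  assumes D: "distributed M lborel Z (\<lambda>z. ennreal (exp (- (cmod z)\<^sup>2) / pi))" and b: "b \<in> Basis"
  shows "distributed M lborel (\<lambda>\<omega>. Z \<omega> \<bullet> b) (normal_density 0 (sqrt (1/2)))"
proof -
  have Z[measurable]: "Z \<in> borel_measurable M"
    using distributed_measurable[OF D] by simp
  have dens: "normal_density 0 (sqrt (1/2)) x = exp (- x\<^sup>2) / sqrt pi" for x
    by (simp add: normal_density_def)
  have split: "exp (- (cmod z)\<^sup>2) / pi = (\<Prod>c\<in>Basis. normal_density 0 (sqrt (1/2)) (z \<bullet> c))" for z
    by (simp add: Basis_complex_def dens cmod_power2 exp_add[symmetric] inner_complex_def)
  have "distr M lborel (\<lambda>\<omega>. Z \<omega> \<bullet> b) = density lborel (normal_density 0 (sqrt (1/2)))"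
  proof (rule measure_eqI)
    fix A assume "A \<in> sets (distr M lborel (\<lambda>\<omega>. Z \<omega> \<bullet> b))"
    then have [measurable]: "A \<in> sets borel" by simp
    \<comment> \<open>The indicator of \<open>A\<close> is attached to the factor of coordinate
      \<open>b\<close> only, so the other factor integrates to 1.\<close>
    define g where "g c x = ennreal (normal_density 0 (sqrt (1/2)) x) * (if c = b then indicator A x else 1)" for c x
    have [measurable]: "g c \<in> borel_measurable borel" for c
      unfolding g_def by (cases "c = b") auto
    have one: "(\<integral>\<^sup>+x. ennreal (normal_density 0 (sqrt (1/2)) x) \<partial>lborel) = 1"
      by (subst nn_integral_eq_integral) auto
    have "emeasure (distr M lborel (\<lambda>\<omega>. Z \<omega> \<bullet> b)) A = (\<integral>\<^sup>+x. indicator A x \<partial>distr M lborel (\<lambda>\<omega>. Z \<omega> \<bullet> b))"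
      by simp
    also have "\<dots> = (\<integral>\<^sup>+\<omega>. indicator A (Z \<omega> \<bullet> b) \<partial>M)"
      by (subst nn_integral_distr) simp_all
    also have "\<dots> = (\<integral>\<^sup>+z. ennreal (exp (- (cmod z)\<^sup>2) / pi) * indicator A (z \<bullet> b) \<partial>lborel)"
      by (subst distributed_nn_integral[OF D]) simp_all
    also have "\<dots> = (\<integral>\<^sup>+z. (\<Prod>c\<in>Basis. g c (z \<bullet> c)) \<partial>lborel)"
    proof (rule nn_integral_cong)
      fix z :: complex
      have "(\<Prod>c\<in>Basis. g c (z \<bullet> c)) = (\<Prod>c\<in>Basis. ennreal (normal_density 0 (sqrt (1/2)) (z \<bullet> c)))
          * (\<Prod>c\<in>Basis. if c = b then indicator A (z \<bullet> b) else 1)"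
        unfolding prod.distrib[symmetric] g_def by (intro prod.cong) auto
      also have "(\<Prod>c\<in>Basis. if c = b then indicator A (z \<bullet> b) else 1) = (indicator A (z \<bullet> b) :: ennreal)"
        using b by simp
      also have "(\<Prod>c\<in>Basis. ennreal (normal_density 0 (sqrt (1/2)) (z \<bullet> c))) = ennreal (exp (- (cmod z)\<^sup>2) / pi)"
        unfolding split by (intro prod_ennreal) simp
      finally show "ennreal (exp (- (cmod z)\<^sup>2) / pi) * indicator A (z \<bullet> b) = (\<Prod>c\<in>Basis. g c (z \<bullet> c))" by simp
    qed
    also have "\<dots> = (\<Prod>c\<in>(Basis::complex set). \<integral>\<^sup>+x. g c x \<partial>lborel)"
      by (rule nn_integral_lborel_prod) simp_all
    also have "\<dots> = (\<Prod>c\<in>Basis. if c = b then \<integral>\<^sup>+x. g b x \<partial>lborel else 1)"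
      by (intro prod.cong refl) (auto simp: g_def one)
    also have "\<dots> = (\<integral>\<^sup>+x. g b x \<partial>lborel)" using b by simp
    also have "\<dots> = emeasure (density lborel (normal_density 0 (sqrt (1/2)))) A"
      by (simp add: g_def emeasure_density)
    finally show "emeasure (distr M lborel (\<lambda>\<omega>. Z \<omega> \<bullet> b)) A = emeasure (density lborel (normal_density 0 (sqrt (1/2)))) A" .
  qed simp
  then show ?thesis by (simp add: distributed_def)
qed

text \<open>All moments reduce to those of the real and imaginary parts. For the fourth moment a
  bound suffices: \<open>cmod z ^ 4\<close> is at most twice the sum of the fourth powers of the
  parts, each of mean 3/4, which gives 3 (the exact value is 2).\<close>

lemma (in prob_space) complex_gaussian_moments:
  fixes Z :: "'a \<Rightarrow> complex"
  assumes D: "distributed M lborel Z (\<lambda>z. ennreal (exp (- (cmod z)\<^sup>2) / pi))"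
  shows "integrable M Z" "expectation Z = 0"
    and "integrable M (\<lambda>\<omega>. (cmod (Z \<omega>))\<^sup>2)" "expectation (\<lambda>\<omega>. (cmod (Z \<omega>))\<^sup>2) = 1"
    and "integrable M (\<lambda>\<omega>. cmod (Z \<omega>) ^ 4)" "expectation (\<lambda>\<omega>. cmod (Z \<omega>) ^ 4) \<le> 3"
proof -
  have [measurable]: "Z \<in> borel_measurable M"
    using distributed_measurable[OF D] by simp
  have comp: "distributed M lborel (\<lambda>\<omega>. Re (Z \<omega>)) (normal_density 0 (sqrt (1/2)))"
      "distributed M lborel (\<lambda>\<omega>. Im (Z \<omega>)) (normal_density 0 (sqrt (1/2)))"
    using distributed_complex_gaussian_component[OF D, of 1]
      distributed_complex_gaussian_component[OF D, of \<i>]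
    by (simp_all add: Basis_complex_def inner_complex_def)
  have mom: "integrable M (\<lambda>\<omega>. X \<omega> ^ k)" "expectation X = 0" "expectation (\<lambda>\<omega>. (X \<omega>)\<^sup>2) = 1 / 2"
      "expectation (\<lambda>\<omega>. X \<omega> ^ 4) = 3 / 4"
    if "distributed M lborel X (normal_density 0 (sqrt (1/2)))" for X :: "'a \<Rightarrow> real" and k
  proof -
    show "integrable M (\<lambda>\<omega>. X \<omega> ^ k)"
      using integrable_normal_moment[where \<mu>=0 and \<sigma>="sqrt (1/2)" and k=k]
      by (subst distributed_integrable[OF that, symmetric]) simp_all
    show "expectation X = 0"
      using integral_normal_moment_odd[of "sqrt (1/2)" 0 0]
      by (subst distributed_integral[OF that, symmetric]) simp_all
    show "expectation (\<lambda>\<omega>. (X \<omega>)\<^sup>2) = 1 / 2"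
      using integral_normal_moment_even[of "sqrt (1/2)" 0 1]
      by (subst distributed_integral[OF that, symmetric]) simp_all
    show "expectation (\<lambda>\<omega>. X \<omega> ^ 4) = 3 / 4"
      using integral_normal_moment_even[of "sqrt (1/2)" 0 2]
      by (subst distributed_integral[OF that, symmetric]) (simp_all add: fact_numeral)
  qed
  have int: "integrable M (\<lambda>\<omega>. Re (Z \<omega>) ^ k)" "integrable M (\<lambda>\<omega>. Im (Z \<omega>) ^ k)" for k
    by (intro mom(1) comp)+
  show sq: "integrable M (\<lambda>\<omega>. (cmod (Z \<omega>))\<^sup>2)"
    unfolding cmod_power2 using int by simp
  show "expectation (\<lambda>\<omega>. (cmod (Z \<omega>))\<^sup>2) = 1"
    unfolding cmod_power2 using int by (simp add: mom(3)[OF comp(1)] mom(3)[OF comp(2)])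
  show Zint: "integrable M Z"
  proof (rule integrable_norm_cancel)
    show "integrable M (\<lambda>\<omega>. norm (Z \<omega>))"
      by (rule square_integrable_imp_integrable) (use sq in simp_all)
  qed simp
  show "expectation Z = 0"
    using Zint mom(2)[OF comp(1)] mom(2)[OF comp(2)] by (simp add: complex_eq_iff)
  have le: "cmod z ^ 4 \<le> 2 * (Re z ^ 4 + Im z ^ 4)" for z
  proof -
    have "cmod z ^ 4 = ((Re z)\<^sup>2 + (Im z)\<^sup>2)\<^sup>2"
      using cmod_power2[of z] by (simp add: power_mult[symmetric] flip: cmod_power2)
    also have "\<dots> \<le> 2 * (((Re z)\<^sup>2)\<^sup>2 + ((Im z)\<^sup>2)\<^sup>2)"
      using sum_squares_bound[of "(Re z)\<^sup>2" "(Im z)\<^sup>2"] by (simp add: power2_sum)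
    finally show ?thesis by (simp add: power_mult[symmetric])
  qed
  have int4: "integrable M (\<lambda>\<omega>. 2 * (Re (Z \<omega>) ^ 4 + Im (Z \<omega>) ^ 4))" using int by simp
  show fourth: "integrable M (\<lambda>\<omega>. cmod (Z \<omega>) ^ 4)"
    by (rule Bochner_Integration.integrable_bound[OF int4]) (use le in \<open>auto intro!: AE_I2\<close>)
  have "expectation (\<lambda>\<omega>. cmod (Z \<omega>) ^ 4) \<le> expectation (\<lambda>\<omega>. 2 * (Re (Z \<omega>) ^ 4 + Im (Z \<omega>) ^ 4))"
    by (intro integral_mono fourth int4 le)
  also have "\<dots> = 3"
    using int by (simp add: mom(4)[OF comp(1)] mom(4)[OF comp(2)])
  finally show "expectation (\<lambda>\<omega>. cmod (Z \<omega>) ^ 4) \<le> 3" .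
qed

text \<open>The centred products \<open>Z m\<close> have bounded second moments: by the fourth
  Gaussian moment if \<open>i = j\<close>, by independence within row \<open>m\<close> otherwise.
  Different rows are independent, so the \<open>Z m\<close> are orthogonal and the strong law
  applies.\<close>

lemma (in prob_space) gram_average_tendsto:
  fixes h :: "nat \<Rightarrow> nat \<Rightarrow> 'a \<Rightarrow> complex"
  assumes ind: "indep_vars (\<lambda>_. borel) (\<lambda>(m,i). h m i) (UNIV \<times> {..<N})"
    and D: "\<And>m i. i < N \<Longrightarrow> distributed M lborel (h m i) (\<lambda>z. ennreal (exp (- (cmod z)\<^sup>2) / pi))"
    and i: "i < N" and j: "j < N"
  shows "AE \<omega> in M. (\<lambda>n. (\<Sum>m<n. cnj (h m i \<omega>) * h m j \<omega>) / of_nat n) \<longlonglongrightarrow> (if i = j then 1 else 0)"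
proof -
  define \<delta> :: complex where "\<delta> = (if i = j then 1 else 0)"
  define Z where "Z m \<omega> = cnj (h m i \<omega>) * h m j \<omega> - \<delta>" for m \<omega>
  have hm[measurable]: "h m i \<in> borel_measurable M" "h m j \<in> borel_measurable M" for m
    using distributed_measurable[OF D[OF i]] distributed_measurable[OF D[OF j]] by simp_all
  have [measurable]: "cnj \<in> borel_measurable borel"
    by (intro borel_measurable_continuous_onI continuous_on_cnj continuous_on_id)
  have Zm: "Z m \<in> borel_measurable M" for m
    unfolding Z_def by measurable
  note mom_i = complex_gaussian_moments[OF D[OF i]] and mom_j = complex_gaussian_moments[OF D[OF j]]
  \<comment> \<open>Functions of entries with disjoint index sets are independent. This serves
    twice: for two entries of one row, and for the pairs of entries in two different rows.\<close>
  have indep: "indep_var borel (\<lambda>\<omega>. f (\<lambda>p\<in>A. case p of (m,i) \<Rightarrow> h m i \<omega>)) borel (\<lambda>\<omega>. g (\<lambda>p\<in>B. case p of (m,i) \<Rightarrow> h m i \<omega>))"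
    if "A \<inter> B = {}" "A \<subseteq> UNIV \<times> {..<N}" "B \<subseteq> UNIV \<times> {..<N}"
      "f \<in> borel_measurable (PiM A (\<lambda>_. borel))" "g \<in> borel_measurable (PiM B (\<lambda>_. borel))"
    for A B and f g :: "(nat \<times> nat \<Rightarrow> complex) \<Rightarrow> complex"
    using indep_var_compose[OF indep_var_restrict[OF ind that(1-3)] that(4,5)]
    by (simp add: comp_def case_prod_unfold)
  have gram: "integrable M (\<lambda>\<omega>. cnj (h m i \<omega>) * h m j \<omega>)
      \<and> expectation (\<lambda>\<omega>. cnj (h m i \<omega>) * h m j \<omega>) = \<delta>
      \<and> integrable M (\<lambda>\<omega>. (cmod (cnj (h m i \<omega>) * h m j \<omega>))\<^sup>2)
      \<and> expectation (\<lambda>\<omega>. (cmod (cnj (h m i \<omega>) * h m j \<omega>))\<^sup>2) \<le> 3" for m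
  proof (cases "i = j")
    case True
    have "cnj z * z = complex_of_real ((cmod z)\<^sup>2)" for z
      by (subst complex_norm_square) (rule mult.commute)
    moreover have "(cmod (complex_of_real ((cmod z)\<^sup>2)))\<^sup>2 = cmod z ^ 4" for z
      by (simp add: norm_power power_mult[symmetric])
    ultimately show ?thesis
      using True mom_i(3,4,5,6)[of m]
      by (simp only: complex_of_real_integrable_eq integral_complex_of_real \<delta>_def) simp
  next
    case False
    have "indep_var borel (\<lambda>\<omega>. cnj (h m i \<omega>)) borel (\<lambda>\<omega>. h m j \<omega>)"
      using indep[of "{(m,i)}" "{(m,j)}" "\<lambda>x. cnj (x (m,i))" "\<lambda>x. x (m,j)"] False i j by simp
    note 1 = indep_var_lebesgue_integral[OF this] indep_var_integrable[OF this]
    \<comment> \<open>The squared moduli are viewed as complex numbers to fit the type of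
      \<open>f\<close> and \<open>g\<close> in \<open>indep\<close>; the embedding is removed again
      in \<open>3\<close> and \<open>4\<close>.\<close>
    have "indep_var borel (\<lambda>\<omega>. complex_of_real ((cmod (h m i \<omega>))\<^sup>2)) borel (\<lambda>\<omega>. complex_of_real ((cmod (h m j \<omega>))\<^sup>2))"
      using indep[of "{(m,i)}" "{(m,j)}" "\<lambda>x. complex_of_real ((cmod (x (m,i)))\<^sup>2)" "\<lambda>x. complex_of_real ((cmod (x (m,j)))\<^sup>2)"]
        False i j by simp
    note 2 = indep_var_lebesgue_integral[OF this] indep_var_integrable[OF this]
    have 3: "integrable M (\<lambda>\<omega>. (cmod (h m i \<omega>))\<^sup>2 * (cmod (h m j \<omega>))\<^sup>2)"
      using 2(2) mom_i(3)[of m] mom_j(3)[of m]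
      by (simp only: of_real_mult[symmetric] complex_of_real_integrable_eq)
    have "complex_of_real (expectation (\<lambda>\<omega>. (cmod (h m i \<omega>))\<^sup>2 * (cmod (h m j \<omega>))\<^sup>2)) = 1"
      using 2(1) mom_i(3,4)[of m] mom_j(3,4)[of m]
      by (simp only: of_real_mult[symmetric] complex_of_real_integrable_eq integral_complex_of_real) simp
    then have 4: "expectation (\<lambda>\<omega>. (cmod (h m i \<omega>))\<^sup>2 * (cmod (h m j \<omega>))\<^sup>2) = 1"
      by (simp only: of_real_eq_1_iff)
    show ?thesis
      using 1 3 4 mom_i(1,2)[of m] mom_j(1,2)[of m] False
      by (simp add: \<delta>_def norm_mult power_mult_distrib)
  qed
  have le: "(cmod (Z m \<omega>))\<^sup>2 \<le> 2 * (cmod (cnj (h m i \<omega>) * h m j \<omega>))\<^sup>2 + 2" for m \<omega>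
  proof -
    have "cmod (Z m \<omega>) \<le> cmod (cnj (h m i \<omega>) * h m j \<omega>) + cmod \<delta>"
      unfolding Z_def by (rule norm_triangle_ineq4)
    also have "\<dots> \<le> cmod (cnj (h m i \<omega>) * h m j \<omega>) + 1" by (simp add: \<delta>_def)
    finally have "(cmod (Z m \<omega>))\<^sup>2 \<le> (cmod (cnj (h m i \<omega>) * h m j \<omega>) + 1)\<^sup>2"
      by (rule power_mono) simp
    also have "\<dots> \<le> 2 * (cmod (cnj (h m i \<omega>) * h m j \<omega>))\<^sup>2 + 2"
      using sum_squares_bound[of "cmod (cnj (h m i \<omega>) * h m j \<omega>)" 1] by (simp only: power2_sum) simp
    finally show ?thesis .
  qed
  have bound_int: "integrable M (\<lambda>\<omega>. 2 * (cmod (cnj (h m i \<omega>) * h m j \<omega>))\<^sup>2 + 2)" for m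
    using gram[of m] by (intro Bochner_Integration.integrable_add integrable_mult_right) simp_all
  have Zsq: "integrable M (\<lambda>\<omega>. (cmod (Z m \<omega>))\<^sup>2)" for m
    by (rule Bochner_Integration.integrable_bound[OF bound_int[of m]])
      (use le[of m] Zm[of m] in \<open>auto intro!: AE_I2\<close>)
  \<comment> \<open>The constant is 8 = 2 * 3 + 2, from \<open>le\<close> and the second-moment
    bound 3 in \<open>gram\<close>.\<close>
  have Zbound: "expectation (\<lambda>\<omega>. (cmod (Z m \<omega>))\<^sup>2) \<le> 8" for m
  proof -
    have "expectation (\<lambda>\<omega>. (cmod (Z m \<omega>))\<^sup>2) \<le> expectation (\<lambda>\<omega>. 2 * (cmod (cnj (h m i \<omega>) * h m j \<omega>))\<^sup>2 + 2)"
      by (intro integral_mono Zsq bound_int le)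
    also have "\<dots> = 2 * expectation (\<lambda>\<omega>. (cmod (cnj (h m i \<omega>) * h m j \<omega>))\<^sup>2) + 2"
      using gram[of m] by (subst Bochner_Integration.integral_add) (auto simp: prob_space)
    finally show ?thesis using gram[of m] by linarith
  qed
  have Zint: "integrable M (Z m)" and Zmean: "expectation (Z m) = 0" for m
    using gram[of m] unfolding Z_def by (simp_all add: prob_space)
  have orth: "expectation (\<lambda>\<omega>. Z m \<omega> \<bullet> Z n \<omega>) = 0" if "m \<noteq> n" for m n
  proof -
    \<comment> \<open>The real inner product of two complex numbers is the real part of the
      conjugate of the first times the second, so the conjugated variable is the one to pair with
      \<open>Z n\<close>.\<close>
    have "indep_var borel (\<lambda>\<omega>. cnj (Z m \<omega>)) borel (Z n)"
      using indep[of "{(m,i),(m,j)}" "{(n,i),(n,j)}" "\<lambda>x. cnj (cnj (x (m,i)) * x (m,j) - \<delta>)" "\<lambda>x. cnj (x (n,i)) * x (n,j) - \<delta>"]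
        that i j by (simp add: Z_def[abs_def])
    note Zprod = indep_var_lebesgue_integral[OF this] indep_var_integrable[OF this]
    have "expectation (\<lambda>\<omega>. Z m \<omega> \<bullet> Z n \<omega>) = expectation (\<lambda>\<omega>. Re (cnj (Z m \<omega>) * Z n \<omega>))"
      by (simp add: inner_complex_def)
    also have "\<dots> = Re (expectation (\<lambda>\<omega>. cnj (Z m \<omega>) * Z n \<omega>))"
      using Zprod(2) Zint by (intro integral_Re) simp_all
    also have "\<dots> = 0" using Zprod(1) Zint Zmean by simp
    finally show ?thesis .
  qed
  have "AE \<omega> in M. (\<lambda>n. (\<Sum>m<n. Z m \<omega>) /\<^sub>R real n) \<longlonglongrightarrow> 0"
    by (rule strong_law_orthogonal[OF Zm Zsq orth Zbound])
  then show ?thesis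
  proof eventually_elim
    case (elim \<omega>)
    then have "(\<lambda>n. (\<Sum>m<n. Z m \<omega>) /\<^sub>R real n + \<delta>) \<longlonglongrightarrow> 0 + \<delta>"
      by (intro tendsto_add tendsto_const)
    moreover have "eventually (\<lambda>n. (\<Sum>m<n. Z m \<omega>) /\<^sub>R real n + \<delta> = (\<Sum>m<n. cnj (h m i \<omega>) * h m j \<omega>) / of_nat n) sequentially"
      using eventually_gt_at_top[of 0]
      by eventually_elim (simp add: Z_def sum_subtractf scaleR_conv_of_real field_simps)
    ultimately show ?case
      unfolding \<delta>_def by (simp add: filterlim_cong)
  qed
qed

section \<open>The limit of the quadratic form\<close>

text \<open>Multiply equation \<open>m\<close> by \<open>cnj (x m)\<close> and sum: moving the
  matrix \<open>b\<close> to the other side turns the coupling term into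
  \<open>v i * (cmod (y i))\<^sup>2\<close>. With \<open>r = 0\<close> the identity yields
  invertibility of the covariance matrix; with \<open>r\<close> the row sums of \<open>b\<close> it
  yields the bound on \<open>y\<close> uniform in \<open>M\<close>.\<close>

lemma gram_system_energy:
  fixes b :: "nat \<Rightarrow> nat \<Rightarrow> complex" and x r y :: "nat \<Rightarrow> complex" and v :: "nat \<Rightarrow> real"
  assumes y: "\<And>i. i < N \<Longrightarrow> y i = (\<Sum>m<M. cnj (b m i) * x m)"
    and sys: "\<And>m. m < M \<Longrightarrow> (\<Sum>i<N. b m i * (v i * y i)) + complex_of_real s * x m = r m"
  shows "complex_of_real ((\<Sum>i<N. v i * (cmod (y i))\<^sup>2) + s * (\<Sum>m<M. (cmod (x m))\<^sup>2))
    = (\<Sum>m<M. cnj (x m) * r m)"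
proof -
  have "(\<Sum>m<M. cnj (x m) * r m) = (\<Sum>m<M. cnj (x m) * ((\<Sum>i<N. b m i * (v i * y i)) + complex_of_real s * x m))"
    by (intro sum.cong) (simp_all add: sys)
  also have "\<dots> = (\<Sum>m<M. \<Sum>i<N. cnj (x m) * (b m i * (v i * y i))) + (\<Sum>m<M. s * (cnj (x m) * x m))"
    by (simp add: distrib_left sum.distrib sum_distrib_left mult.left_commute)
  also have "(\<Sum>m<M. \<Sum>i<N. cnj (x m) * (b m i * (v i * y i))) = (\<Sum>i<N. (\<Sum>m<M. cnj (x m) * b m i) * (v i * y i))"
    by (subst sum.swap) (simp add: sum_distrib_right mult.assoc)
  also have "\<dots> = (\<Sum>i<N. v i * (cnj (y i) * y i))"
    by (intro sum.cong refl) (simp add: y mult.left_commute mult.commute)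
  finally have "(\<Sum>m<M. cnj (x m) * r m) = (\<Sum>i<N. v i * (cnj (y i) * y i)) + (\<Sum>m<M. s * (cnj (x m) * x m))" .
  moreover have "cnj z * z = (complex_of_real (cmod z))\<^sup>2" for z
    by (metis complex_norm_square mult.commute of_real_power)
  ultimately show ?thesis
    by (simp add: sum_distrib_left)
qed

text \<open>Young's inequality, \<open>t i \<le> v i * (t i)\<^sup>2 / 2 + 1 / (2 * v i)\<close>,
  lets half of the quadratic sum absorb the linear one. The resulting bound depends on the weights
  alone.\<close>

lemma square_sum_le_of_le_sum:
  fixes t v :: "nat \<Rightarrow> real"
  assumes v: "\<And>i. i < N \<Longrightarrow> v i > 0"
    and le: "(\<Sum>i<N. v i * (t i)\<^sup>2) \<le> (\<Sum>i<N. t i)" and i: "i < N"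
  shows "\<bar>t i\<bar> \<le> sqrt ((\<Sum>i<N. 1 / v i) / v i)"
proof -
  have "(\<Sum>i<N. t i) \<le> (\<Sum>i<N. v i * (t i)\<^sup>2 / 2 + 1 / v i / 2)"
  proof (rule sum_mono)
    fix i assume "i \<in> {..<N}"
    then have "v i > 0" using v by simp
    then have "v i * (t i)\<^sup>2 / 2 + 1 / v i / 2 - t i = (v i * t i - 1)\<^sup>2 / (2 * v i)"
      by (simp add: field_simps power2_eq_square)
    also have "\<dots> \<ge> 0" using \<open>v i > 0\<close> by simp
    finally show "t i \<le> v i * (t i)\<^sup>2 / 2 + 1 / v i / 2" by simp
  qed
  also have "\<dots> = (\<Sum>i<N. v i * (t i)\<^sup>2) / 2 + (\<Sum>i<N. 1 / v i) / 2"
    by (simp add: sum.distrib sum_divide_distrib)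
  finally have "(\<Sum>i<N. v i * (t i)\<^sup>2) \<le> (\<Sum>i<N. 1 / v i)" using le by simp
  moreover have "v i * (t i)\<^sup>2 \<le> (\<Sum>i<N. v i * (t i)\<^sup>2)"
    using i v by (intro member_le_sum) (auto simp: less_imp_le)
  ultimately have "(t i)\<^sup>2 \<le> (\<Sum>i<N. 1 / v i) / v i"
    using v[OF i] by (simp add: pos_le_divide_eq mult.commute)
  then show ?thesis using real_sqrt_le_mono by fastforce
qed

text \<open>Replacing row \<open>i\<close> of \<open>G\<close> by its limit \<open>\<Gamma>\<close>
  leaves the error \<open>R\<close>, which vanishes in the limit because the energy inequality keeps
  \<open>y\<close> bounded. The limiting row is diagonal, so it becomes the scalar equation
  \<open>(s + \<gamma> i * v i) * y M i = \<gamma> i + R M\<close>, solved by division by a positive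
  number.\<close>

lemma gram_system_tendsto:
  fixes G :: "nat \<Rightarrow> nat \<Rightarrow> nat \<Rightarrow> complex" and y :: "nat \<Rightarrow> nat \<Rightarrow> complex" and v \<gamma> :: "nat \<Rightarrow> real"
  assumes s: "s > 0" and v: "\<And>i. i < N \<Longrightarrow> v i > 0" and \<gamma>: "\<And>i. i < N \<Longrightarrow> \<gamma> i \<ge> 0"
    and G: "\<And>i j. i < N \<Longrightarrow> j < N \<Longrightarrow> (\<lambda>M. G M i j) \<longlonglongrightarrow> (if i = j then complex_of_real (\<gamma> i) else 0)"
    and sys: "\<And>i. i < N \<Longrightarrow>
      eventually (\<lambda>M. s * y M i + (\<Sum>j<N. G M i j * (v j * y M j)) = (\<Sum>j<N. G M i j)) sequentially"
    and energy: "eventually (\<lambda>M. (\<Sum>i<N. v i * (cmod (y M i))\<^sup>2) \<le> (\<Sum>i<N. cmod (y M i))) sequentially"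
    and i: "i < N"
  shows "(\<lambda>M. y M i) \<longlonglongrightarrow> complex_of_real (\<gamma> i / (s + \<gamma> i * v i))"
proof -
  define \<Gamma> where "\<Gamma> j = (if i = j then complex_of_real (\<gamma> i) else 0)" for j
  define K where "K j = sqrt ((\<Sum>i<N. 1 / v i) / v j)" for j
  define R where "R M = (\<Sum>j<N. (G M i j - \<Gamma> j) * (1 - v j * y M j))" for M
  have pos: "s + \<gamma> i * v i > 0"
    using s \<gamma>[OF i] v[OF i] by (simp add: add_pos_nonneg)
  have "R \<longlonglongrightarrow> 0"
  proof (rule Lim_null_comparison)
    show "eventually (\<lambda>M. norm (R M) \<le> (\<Sum>j<N. norm (G M i j - \<Gamma> j) * (1 + v j * K j))) sequentially"
      using energy
    proof eventually_elim
      case (elim M)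
      show ?case unfolding R_def
      proof (rule sum_norm_le)
        fix j assume j: "j \<in> {..<N}"
        then have "cmod (y M j) \<le> K j"
          using square_sum_le_of_le_sum[where v=v, OF v elim, of j] by (simp add: K_def)
        moreover have "cmod (1 - v j * y M j) \<le> 1 + v j * cmod (y M j)"
          using norm_triangle_ineq4[of 1 "v j * y M j"] v[of j] j by (simp add: norm_mult)
        ultimately have "cmod (1 - v j * y M j) \<le> 1 + v j * K j"
          using v[of j] j by (smt (verit) lessThan_iff mult_left_mono)
        then show "cmod ((G M i j - \<Gamma> j) * (1 - v j * y M j)) \<le> cmod (G M i j - \<Gamma> j) * (1 + v j * K j)"
          by (simp add: norm_mult mult_left_mono)
      qed
    qed
    have "(\<lambda>M. norm (G M i j - \<Gamma> j)) \<longlonglongrightarrow> 0" if "j < N" for j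
      using G[OF i that] unfolding \<Gamma>_def by (intro tendsto_norm_zero LIM_zero)
    then show "(\<lambda>M. \<Sum>j<N. norm (G M i j - \<Gamma> j) * (1 + v j * K j)) \<longlonglongrightarrow> 0"
      by (intro tendsto_null_sum tendsto_mult_left_zero) simp
  qed
  then have "(\<lambda>M. (complex_of_real (\<gamma> i) + R M) / complex_of_real (s + \<gamma> i * v i)) \<longlonglongrightarrow> (complex_of_real (\<gamma> i) + 0) / complex_of_real (s + \<gamma> i * v i)"
    using pos by (intro tendsto_divide tendsto_add tendsto_const) (simp_all del: of_real_add of_real_mult)
  moreover have "eventually (\<lambda>M. (complex_of_real (\<gamma> i) + R M) / complex_of_real (s + \<gamma> i * v i) = y M i) sequentially"
    using sys[OF i]
  proof eventually_elim
    case (elim M)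
    \<comment> \<open>By the system, the first two sums on the right differ by exactly
      \<open>s * y M i\<close>.\<close>
    have "R M = (\<Sum>j<N. G M i j) - (\<Sum>j<N. G M i j * (v j * y M j)) - (\<Sum>j<N. \<Gamma> j * (1 - v j * y M j))"
      by (simp add: R_def left_diff_distrib right_diff_distrib sum_subtractf)
    also have "(\<Sum>j<N. \<Gamma> j * (1 - v j * y M j)) = (\<Sum>j<N. if i = j then \<gamma> i * (1 - v i * y M i) else 0)"
      by (intro sum.cong) (auto simp: \<Gamma>_def)
    also have "\<dots> = \<gamma> i * (1 - v i * y M i)" using i by simp
    finally have "complex_of_real (s + \<gamma> i * v i) * y M i = \<gamma> i + R M"
      by (simp add: elim[symmetric] algebra_simps)
    then show ?case
      using pos by (metis less_irrefl nonzero_mult_div_cancel_left of_real_eq_0_iff)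
  qed
  ultimately show ?thesis by (simp add: filterlim_cong)
qed

section \<open>From the matrix expression \<open>g_fun\<close> to scalar sums\<close>

lemma mat_adjoint_eq_mat: "mat_adjoint A = mat (dim_col A) (dim_row A) (\<lambda>(i,j). conjugate (A $$ (j,i)))"
  by (rule eq_matI) (simp_all add: mat_adjoint_def mat_of_rows_def)

lemma mat_adjoint_diag_of: "mat_adjoint (diag_of n x) = diag_of n (\<lambda>i. cnj (x i))"
  by (rule eq_matI) (auto simp: mat_adjoint_eq_mat diag_of_def)

lemma diag_of_carrier [simp]: "diag_of n x \<in> carrier_mat n n"
  by (simp add: diag_of_def)

lemma diag_of_mult_vec:
  "u \<in> carrier_vec n \<Longrightarrow> diag_of n x *\<^sub>v u = vec n (\<lambda>i. x i * u $ i)"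
  by (rule eq_vecI) (auto simp: diag_of_def scalar_prod_def if_distrib[of "\<lambda>z. z * _"] cong: if_cong)

text \<open>The factors act on \<open>x\<close> one after another. The inner sum is component
  \<open>i\<close> of the adjoint of \<open>H D\<close> applied to \<open>x\<close>, so row
  \<open>m\<close> takes the form required by \<open>gram_system_energy\<close> with
  \<open>b m i = H $$ (m,i) * a $ i\<close>.\<close>

lemma covariance_mult_vec:
  fixes H :: "complex mat" and v :: "nat \<Rightarrow> real"
  assumes H: "H \<in> carrier_mat M N" and x: "x \<in> carrier_vec M" and m: "m < M"
  shows "((H * diag_of N (\<lambda>i. a $ i) * diag_of N (\<lambda>i. complex_of_real (v i))
       * mat_adjoint (diag_of N (\<lambda>i. a $ i)) * mat_adjoint H + complex_of_real s \<cdot>\<^sub>m 1\<^sub>m M) *\<^sub>v x) $ m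
    = (\<Sum>i<N. H $$ (m,i) * a $ i * (v i * (\<Sum>l<M. cnj (H $$ (l,i) * a $ i) * x $ l))) + s * x $ m"
proof -
  have adj: "mat_adjoint H \<in> carrier_mat N M" using H by (simp add: mat_adjoint_eq_mat)
  have w: "mat_adjoint H *\<^sub>v x = vec N (\<lambda>i. \<Sum>l<M. cnj (H $$ (l,i)) * x $ l)"
    using H x by (intro eq_vecI) (auto simp: mat_adjoint_eq_mat scalar_prod_def lessThan_atLeast0)
  have carr: "H * diag_of N (\<lambda>i. a $ i) \<in> carrier_mat M N"
    "H * diag_of N (\<lambda>i. a $ i) * diag_of N (\<lambda>i. complex_of_real (v i)) \<in> carrier_mat M N"
    "H * diag_of N (\<lambda>i. a $ i) * diag_of N (\<lambda>i. complex_of_real (v i)) * diag_of N (\<lambda>i. cnj (a $ i)) \<in> carrier_mat M N"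
    using H by (auto intro!: mult_carrier_mat diag_of_carrier)
  have "(H * diag_of N (\<lambda>i. a $ i) * diag_of N (\<lambda>i. complex_of_real (v i))
       * mat_adjoint (diag_of N (\<lambda>i. a $ i)) * mat_adjoint H + complex_of_real s \<cdot>\<^sub>m 1\<^sub>m M) *\<^sub>v x
     = H *\<^sub>v (diag_of N (\<lambda>i. a $ i) *\<^sub>v (diag_of N (\<lambda>i. complex_of_real (v i)) *\<^sub>v (diag_of N (\<lambda>i. cnj (a $ i)) *\<^sub>v (mat_adjoint H *\<^sub>v x))))
       + (complex_of_real s \<cdot>\<^sub>m 1\<^sub>m M) *\<^sub>v x"
    unfolding mat_adjoint_diag_of
    using carr adj x
    by (simp add: add_mult_distrib_mat_vec[where nr=M and nc=M] assoc_mult_mat_vec[OF carr(3) adj]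
        assoc_mult_mat_vec[OF carr(2) diag_of_carrier] assoc_mult_mat_vec[OF carr(1) diag_of_carrier]
        assoc_mult_mat_vec[OF H diag_of_carrier] mult_mat_vec_carrier[OF adj] mult_mat_vec_carrier[OF diag_of_carrier])
  also have "\<dots> $ m = (\<Sum>i<N. H $$ (m,i) * a $ i * (v i * (\<Sum>l<M. cnj (H $$ (l,i) * a $ i) * x $ l))) + s * x $ m"
    using H x m
    by (simp add: w diag_of_mult_vec scalar_prod_def lessThan_atLeast0 sum_distrib_left mult.assoc mult.left_commute if_distrib[of "\<lambda>z. z * _"] if_distrib[of "\<lambda>z. complex_of_real s * z"] cong: if_cong)
  finally show ?thesis .
qed

text \<open>Here \<open>x\<close> is the inverse of \<open>X\<close> applied to \<open>H a\<close>,
  and \<open>y\<close> is the adjoint of \<open>H D\<close> applied to \<open>x\<close>. Since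
  \<open>H a\<close> is \<open>H D\<close> times the all-ones vector, the right-hand sides are row
  sums, and \<open>g_fun\<close> is the sum of the \<open>y i\<close>.\<close>

lemma g_fun_system:
  fixes H :: "complex mat" and v :: "nat \<Rightarrow> real"
  assumes H: "H \<in> carrier_mat M N" and a: "a \<in> carrier_vec N" and s: "s > 0"
    and v: "\<And>i. i < N \<Longrightarrow> v i > 0"
  obtains x y :: "nat \<Rightarrow> complex" where
    "\<And>i. y i = (\<Sum>m<M. cnj (H $$ (m,i) * a $ i) * x m)"
    "\<And>m. m < M \<Longrightarrow> (\<Sum>i<N. H $$ (m,i) * a $ i * (v i * y i)) + complex_of_real s * x m = (\<Sum>i<N. H $$ (m,i) * a $ i)"
    "g_fun N s v H a = (\<Sum>i<N. y i)"
proof -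
  define X where "X = H * diag_of N (\<lambda>i. a $ i) * diag_of N (\<lambda>i. complex_of_real (v i))
       * mat_adjoint (diag_of N (\<lambda>i. a $ i)) * mat_adjoint H + complex_of_real s \<cdot>\<^sub>m 1\<^sub>m M"
  note Xv = covariance_mult_vec[OF H, where a=a and v=v and s=s, folded X_def]
  have X: "X \<in> carrier_mat M M"
    using H by (simp add: X_def mat_adjoint_eq_mat)
  have "det X \<noteq> 0"
  proof
    assume "det X = 0"
    then obtain u where u: "u \<in> carrier_vec M" "u \<noteq> 0\<^sub>v M" "X *\<^sub>v u = 0\<^sub>v M"
      using det_0_iff_vec_prod_zero[OF X] by auto
    \<comment> \<open>A kernel vector \<open>u\<close> solves the system with right-hand side 0, so
      its energy is 0; as \<open>s > 0\<close>, this forces \<open>u = 0\<close>.\<close>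
    have "complex_of_real ((\<Sum>i<N. v i * (cmod (\<Sum>m<M. cnj (H $$ (m,i) * a $ i) * u $ m))\<^sup>2) + s * (\<Sum>m<M. (cmod (u $ m))\<^sup>2))
      = (\<Sum>m<M. cnj (u $ m) * 0)"
      by (rule gram_system_energy[where b="\<lambda>m i. H $$ (m,i) * a $ i"]) (use Xv[OF u(1)] u(3) in simp_all)
    then have "(\<Sum>i<N. v i * (cmod (\<Sum>m<M. cnj (H $$ (m,i) * a $ i) * u $ m))\<^sup>2) + s * (\<Sum>m<M. (cmod (u $ m))\<^sup>2) = 0"
      by (simp only: mult_zero_right sum.neutral_const of_real_eq_0_iff)
    moreover have "(\<Sum>i<N. v i * (cmod (\<Sum>m<M. cnj (H $$ (m,i) * a $ i) * u $ m))\<^sup>2) \<ge> 0"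
      using v by (intro sum_nonneg) (simp add: less_imp_le)
    moreover have "s * (\<Sum>m<M. (cmod (u $ m))\<^sup>2) \<ge> 0"
      using s by (simp add: sum_nonneg)
    ultimately have "s * (\<Sum>m<M. (cmod (u $ m))\<^sup>2) = 0" by linarith
    then have "\<forall>m<M. u $ m = 0"
      using s by (simp add: sum_nonneg_eq_0_iff)
    then have "u = 0\<^sub>v M" using u(1) by (intro eq_vecI) auto
    then show False using u(2) by simp
  qed
  then have "X \<in> Units (ring_mat TYPE(complex) M ())"
    by (rule det_non_zero_imp_unit[OF X])
  \<comment> \<open>Invertibility guarantees that \<open>the (mat_inverse X)\<close> in
    \<open>g_fun\<close> is a genuine inverse.\<close>
  then obtain Y where Y: "mat_inverse X = Some Y"
    using mat_inverse(1)[OF X, where b="()"] by (cases "mat_inverse X") auto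
  then have XY: "X * Y = 1\<^sub>m M" "Y \<in> carrier_mat M M" using mat_inverse(2)[OF X] by auto
  define x where "x = Y *\<^sub>v (H *\<^sub>v a)"
  have x: "x \<in> carrier_vec M" unfolding x_def by (intro mult_mat_vec_carrier[OF XY(2)] mult_mat_vec_carrier[OF H a])
  have Xx: "X *\<^sub>v x = H *\<^sub>v a"
    unfolding x_def using H a XY X
    by (subst assoc_mult_mat_vec[symmetric, where n\<^sub>1=M and n\<^sub>2=M and n\<^sub>3=M]) auto
  show thesis
  proof (rule that[of "\<lambda>i. \<Sum>m<M. cnj (H $$ (m,i) * a $ i) * x $ m" "\<lambda>m. x $ m"])
    fix m assume m: "m < M"
    show "(\<Sum>i<N. H $$ (m,i) * a $ i * (v i * (\<Sum>m<M. cnj (H $$ (m,i) * a $ i) * x $ m))) + complex_of_real s * x $ m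
       = (\<Sum>i<N. H $$ (m,i) * a $ i)"
      using Xv[OF x m] Xx H a m by (simp add: scalar_prod_def lessThan_atLeast0)
  next
    have w: "mat_adjoint H *\<^sub>v x = vec N (\<lambda>i. \<Sum>l<M. cnj (H $$ (l,i)) * x $ l)"
      using H x by (intro eq_vecI) (auto simp: mat_adjoint_eq_mat scalar_prod_def lessThan_atLeast0)
    have "g_fun N s v H a = scalar_prod (conjugate a) (mat_adjoint H *\<^sub>v x)"
      unfolding g_fun_def Let_def using H Y by (simp add: x_def X_def)
    also have "\<dots> = (\<Sum>i<N. \<Sum>m<M. cnj (H $$ (m,i) * a $ i) * x $ m)"
      unfolding w using a by (simp add: scalar_prod_def lessThan_atLeast0 sum_distrib_left mult_ac)
    finally show "g_fun N s v H a = (\<Sum>i<N. \<Sum>m<M. cnj (H $$ (m,i) * a $ i) * x $ m)" .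
  qed simp
qed

section \<open>Convergence along one channel realization\<close>

text \<open>For a single realization, the limits of the channel averages determine those of
  \<open>G\<close>, the Gram matrix of \<open>b M\<close>. On the diagonal the factor
  \<open>M\<close> cancels the scaling of the gains and gives
  \<open>\<gamma> i = c i / d i powr alpha\<close>; off the diagonal the limit is 0. Then
  \<open>gram_system_tendsto\<close> applies.\<close>

lemma g_fun_tendsto:
  fixes h :: "nat \<Rightarrow> nat \<Rightarrow> complex" and a :: "nat \<Rightarrow> complex vec" and c d v :: "nat \<Rightarrow> real"
  assumes gram: "\<And>i j. i < N \<Longrightarrow> j < N \<Longrightarrow>
      (\<lambda>M. (\<Sum>m<M. cnj (h m i) * h m j) / of_nat M) \<longlonglongrightarrow> (if i = j then 1 else 0)"
    and s: "s > 0" and v: "\<And>i. i < N \<Longrightarrow> v i > 0" and d: "\<And>i. i < N \<Longrightarrow> d i > 0"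
    and c: "\<And>i. i < N \<Longrightarrow> c i \<ge> 0"
    and dim: "\<And>M. M \<ge> 1 \<Longrightarrow> dim_vec (a M) = N"
    and gain: "\<And>M i. M \<ge> 1 \<Longrightarrow> i < N \<Longrightarrow> (cmod (a M $ i))\<^sup>2 = c i / real M"
  shows "(\<lambda>M. g_fun N s v (chan_mat M N d alpha h) (a M))
    \<longlonglongrightarrow> complex_of_real (\<Sum>i<N. c i / (s * d i powr alpha + v i * c i))"
proof -
  define q where "q i = sqrt (d i powr alpha)" for i
  have q: "q i > 0" "(q i)\<^sup>2 = d i powr alpha" if "i < N" for i
    using d[OF that] by (simp_all add: q_def)
  define b where "b M m i = h m i / complex_of_real (q i) * a M $ i" for M m i
  define G where "G M i j = (\<Sum>m<M. cnj (b M m i) * b M m j)" for M i j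
  define \<gamma> where "\<gamma> i = c i / d i powr alpha" for i
  \<comment> \<open>Bundling the properties into one predicate lets \<open>x\<close> and
    \<open>y\<close> be chosen for all \<open>M \<ge> 1\<close> at once.\<close>
  define solves where "solves M x y \<longleftrightarrow> (\<forall>i<N. y i = (\<Sum>m<M. cnj (b M m i) * x m))
      \<and> (\<forall>m<M. (\<Sum>i<N. b M m i * (complex_of_real (v i) * y i)) + complex_of_real s * x m = (\<Sum>i<N. b M m i))
      \<and> g_fun N s v (chan_mat M N d alpha h) (a M) = (\<Sum>i<N. y i)" for M and x y :: "nat \<Rightarrow> complex"
  have "\<exists>x y. solves M x y" if M: "M \<ge> 1" for M
  proof -
    have H: "chan_mat M N d alpha h \<in> carrier_mat M N" by (simp add: chan_mat_def)
    have aM: "a M \<in> carrier_vec N" using dim[OF M] by (rule carrier_vecI)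
    obtain x y :: "nat \<Rightarrow> complex" where xy: "\<And>i. y i = (\<Sum>m<M. cnj (chan_mat M N d alpha h $$ (m,i) * a M $ i) * x m)"
      "\<And>m. m < M \<Longrightarrow> (\<Sum>i<N. chan_mat M N d alpha h $$ (m,i) * a M $ i * (v i * y i)) + complex_of_real s * x m
         = (\<Sum>i<N. chan_mat M N d alpha h $$ (m,i) * a M $ i)"
      "g_fun N s v (chan_mat M N d alpha h) (a M) = (\<Sum>i<N. y i)"
      by (rule g_fun_system[OF H aM s, where v=v]) (use v in auto)
    have entry: "chan_mat M N d alpha h $$ (m,i) * a M $ i = b M m i" if "m < M" "i < N" for m i
      using that by (simp add: chan_mat_def b_def q_def)
    show ?thesis unfolding solves_def
    proof (rule exI[of _ x], rule exI[of _ y], intro conjI allI impI)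
      show "y i = (\<Sum>m<M. cnj (b M m i) * x m)" if "i < N" for i
        unfolding xy(1) by (intro sum.cong refl) (simp only: entry that lessThan_iff)
      fix m assume m: "m < M"
      have "(\<Sum>i<N. chan_mat M N d alpha h $$ (m,i) * a M $ i * u i) = (\<Sum>i<N. b M m i * u i)" for u
        by (intro sum.cong refl) (simp add: entry[OF m])
      \<comment> \<open>The row sum on the right carries no factor \<open>u\<close>, so it is
        rewritten by the instance \<open>u = 1\<close>.\<close>
      from xy(2)[OF m, unfolded this] this[of "\<lambda>_. 1"]
      show "(\<Sum>i<N. b M m i * (v i * y i)) + complex_of_real s * x m = (\<Sum>i<N. b M m i)" by simp
    qed (rule xy(3))
  qed
  then obtain x y where sol: "\<And>M. M \<ge> 1 \<Longrightarrow> solves M (x M) (y M)"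
    by metis
  note y = sol[unfolded solves_def, THEN conjunct1, rule_format]
    and sys = sol[unfolded solves_def, THEN conjunct2, THEN conjunct1, rule_format]
    and g = sol[unfolded solves_def, THEN conjunct2, THEN conjunct2]
  have lim: "(\<lambda>M. y M i) \<longlonglongrightarrow> complex_of_real (\<gamma> i / (s + \<gamma> i * v i))" if i: "i < N" for i
  proof (rule gram_system_tendsto[where N=N and G=G, OF s])
    show "eventually (\<lambda>M. s * y M i + (\<Sum>j<N. G M i j * (v j * y M j)) = (\<Sum>j<N. G M i j)) sequentially" if i: "i < N" for i
      using eventually_ge_at_top[of 1]
    proof eventually_elim
      case (elim M)
      \<comment> \<open>Multiplying the \<open>M\<close> equations by the conjugates of column
        \<open>i\<close> of \<open>b M\<close> collapses them to row \<open>i\<close> of a system of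
        fixed size \<open>N\<close>.\<close>
      have "(\<Sum>j<N. G M i j) = (\<Sum>m<M. cnj (b M m i) * (\<Sum>j<N. b M m j))"
        unfolding G_def by (subst sum.swap) (simp add: sum_distrib_left)
      also have "\<dots> = (\<Sum>m<M. cnj (b M m i) * ((\<Sum>j<N. b M m j * (v j * y M j)) + s * x M m))"
        by (intro sum.cong refl) (simp only: sys[OF elim] lessThan_iff)
      also have "\<dots> = (\<Sum>m<M. \<Sum>j<N. cnj (b M m i) * b M m j * (v j * y M j)) + s * y M i"
        by (simp add: y[OF elim i] distrib_left sum.distrib sum_distrib_left mult.assoc mult.left_commute)
      also have "(\<Sum>m<M. \<Sum>j<N. cnj (b M m i) * b M m j * (v j * y M j)) = (\<Sum>j<N. G M i j * (v j * y M j))"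
        unfolding G_def by (subst sum.swap) (simp add: sum_distrib_right)
      finally show ?case by simp
    qed
    show "eventually (\<lambda>M. (\<Sum>i<N. v i * (cmod (y M i))\<^sup>2) \<le> (\<Sum>i<N. cmod (y M i))) sequentially"
      using eventually_ge_at_top[of 1]
    proof eventually_elim
      case (elim M)
      have "complex_of_real ((\<Sum>i<N. v i * (cmod (y M i))\<^sup>2) + s * (\<Sum>m<M. (cmod (x M m))\<^sup>2))
         = (\<Sum>m<M. cnj (x M m) * (\<Sum>i<N. b M m i))"
        by (rule gram_system_energy[where b="b M"]) (use y sys elim in auto)
      \<comment> \<open>Summing over \<open>m\<close> first turns the pairing of \<open>x\<close>
        with the row sums into the conjugate of the sum of \<open>y\<close>. Taking real parts and
        dropping the nonnegative \<open>x\<close> term then gives the energy inequality.\<close>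
      also have "\<dots> = (\<Sum>i<N. cnj (y M i))"
        by (simp add: y[OF elim] sum_distrib_left mult.commute) (rule sum.swap)
      finally have eq: "(\<Sum>i<N. v i * (cmod (y M i))\<^sup>2) + s * (\<Sum>m<M. (cmod (x M m))\<^sup>2) = Re (\<Sum>i<N. cnj (y M i))"
        by (metis Re_complex_of_real)
      have "s * (\<Sum>m<M. (cmod (x M m))\<^sup>2) \<ge> 0" using s by (simp add: sum_nonneg)
      moreover have "Re (\<Sum>i<N. cnj (y M i)) \<le> (\<Sum>i<N. cmod (y M i))"
        by (simp add: sum_mono complex_Re_le_cmod)
      ultimately show ?case using eq by linarith
    qed
    show "(\<lambda>M. G M i j) \<longlonglongrightarrow> (if i = j then complex_of_real (\<gamma> i) else 0)" if i: "i < N" and j: "j < N" for i j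
    proof -
      define A where "A M = (\<Sum>m<M. cnj (h m i) * h m j) / of_nat M" for M
      have A: "A \<longlonglongrightarrow> (if i = j then 1 else 0)" unfolding A_def by (rule gram[OF i j])
      have GA: "G M i j = of_nat M * (cnj (a M $ i) * a M $ j) / (q i * q j) * A M" if "M \<ge> 1" for M
      proof -
        have "G M i j = (cnj (a M $ i) * a M $ j) / (q i * q j) * (\<Sum>m<M. cnj (h m i) * h m j)"
          unfolding G_def b_def by (simp add: sum_distrib_left sum_divide_distrib mult.assoc mult.left_commute mult.commute)
        then show ?thesis using that by (simp add: A_def)
      qed
      show ?thesis
      proof (cases "i = j")
        case True
        have "eventually (\<lambda>M. complex_of_real (\<gamma> i) * A M = G M i j) sequentially"
          using eventually_ge_at_top[of 1]
        proof eventually_elim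
          case (elim M)
          have "cnj (a M $ i) * a M $ i = complex_of_real (c i / real M)"
            unfolding gain[OF elim i, symmetric] complex_norm_square by (rule mult.commute)
          moreover have "complex_of_real (q i) * q i = complex_of_real (d i powr alpha)"
            using q(2)[OF i] by (simp add: power2_eq_square flip: of_real_mult)
          ultimately show ?case
            using elim True GA[OF elim] by (simp add: \<gamma>_def)
        qed
        moreover have "(\<lambda>M. complex_of_real (\<gamma> i) * A M) \<longlonglongrightarrow> complex_of_real (\<gamma> i) * 1"
          using A True by (intro tendsto_intros) simp
        ultimately show ?thesis using True by (simp add: filterlim_cong)
      next
        case False
        \<comment> \<open>The phases of the gains may vary with \<open>M\<close>, so the coefficient
          of \<open>A M\<close> need not converge. Its modulus is the constant
          \<open>sqrt (c i * c j) / (q i * q j)\<close>, and \<open>A\<close> tends to 0.\<close>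
        have "G' \<longlonglongrightarrow> 0" if "G' = (\<lambda>M. G M i j)" for G'
        proof (rule Lim_null_comparison)
          show "eventually (\<lambda>M. norm (G' M) \<le> sqrt (c i * c j) / (q i * q j) * norm (A M)) sequentially"
            using eventually_ge_at_top[of 1]
          proof eventually_elim
            case (elim M)
            have "cmod (a M $ k) = sqrt (c k) / sqrt (real M)" if "k < N" for k
              using gain[OF elim that] by (metis norm_ge_zero real_sqrt_divide real_sqrt_unique)
            then have "cmod (of_nat M * (cnj (a M $ i) * a M $ j)) = sqrt (c i * c j)"
              using elim i j by (simp add: norm_mult real_sqrt_mult)
            then show ?case
              using q(1)[OF i] q(1)[OF j] by (simp only: that GA[OF elim] norm_mult norm_divide) (simp add: norm_mult)
          qed
          show "(\<lambda>M. sqrt (c i * c j) / (q i * q j) * norm (A M)) \<longlonglongrightarrow> 0"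
            using A False by (intro tendsto_mult_right_zero tendsto_norm_zero) simp
        qed
        then show ?thesis using False by simp
      qed
    qed
  qed (use v c d i in \<open>simp_all add: \<gamma>_def\<close>)
  have "(\<lambda>M. \<Sum>i<N. y M i) \<longlonglongrightarrow> (\<Sum>i<N. complex_of_real (\<gamma> i / (s + \<gamma> i * v i)))"
    by (intro tendsto_sum lim) simp
  also have "(\<Sum>i<N. complex_of_real (\<gamma> i / (s + \<gamma> i * v i))) = complex_of_real (\<Sum>i<N. c i / (s * d i powr alpha + v i * c i))"
    unfolding of_real_sum
  proof (intro sum.cong refl arg_cong[where f=complex_of_real])
    fix i assume "i \<in> {..<N}"
    then have "d i powr alpha > 0" using d[of i] by simp
    then show "\<gamma> i / (s + \<gamma> i * v i) = c i / (s * d i powr alpha + v i * c i)"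
      by (simp add: \<gamma>_def field_simps)
  qed
  finally show ?thesis
    by (rule Lim_transform_eventually) (use eventually_ge_at_top[of 1] in \<open>eventually_elim, simp add: g\<close>)
qed

section \<open>Almost sure limits of the quadratic form and the detection probability\<close>

theorem theorem1:
  fixes P :: "'w measure"
    and h :: "nat \<Rightarrow> nat \<Rightarrow> 'w \<Rightarrow> complex"
    and N :: nat
    and c d sv2 :: "nat \<Rightarrow> real"
    and alpha sn2 st2 \<epsilon> :: real
    and a :: "nat \<Rightarrow> complex vec"
  assumes "prob_space P"
    and "prob_space.indep_vars P (\<lambda>_. borel) (\<lambda>(m,i). h m i) (UNIV \<times> {..<N})"
    and "\<And>m i. i < N \<Longrightarrow>
           distributed P lborel (h m i) (\<lambda>z. ennreal (exp (- (cmod z)\<^sup>2) / pi))"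
    and "sn2 > 0" and "st2 > 0" and "alpha > 0"
    and "\<And>i. i < N \<Longrightarrow> sv2 i > 0"
    and "\<And>i. i < N \<Longrightarrow> d i > 0"
    and "\<And>i. i < N \<Longrightarrow> c i \<ge> 0"
    and "\<And>M. M \<ge> 1 \<Longrightarrow> dim_vec (a M) = N"
    and "\<And>M i. M \<ge> 1 \<Longrightarrow> i < N \<Longrightarrow> (cmod (a M $ i))\<^sup>2 = c i / real M"
    and "0 < \<epsilon>" and "\<epsilon> \<le> 1"
  shows "AE \<omega> in P.
      ((\<lambda>M. g_fun N sn2 sv2 (chan_mat M N d alpha (\<lambda>m i. h m i \<omega>)) (a M))
         \<longlonglongrightarrow> complex_of_real (\<Sum>i<N. c i / (sn2 * d i powr alpha + sv2 i * c i)))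
    \<and> ((\<lambda>M. \<epsilon> powr (1 / (1 + st2 * Re (g_fun N sn2 sv2 (chan_mat M N d alpha (\<lambda>m i. h m i \<omega>)) (a M)))))
         \<longlonglongrightarrow> \<epsilon> powr (1 / (1 + st2 * (\<Sum>i<N. c i / (sn2 * d i powr alpha + sv2 i * c i)))))"
proof -
  interpret prob_space P by fact
  define L where "L = (\<Sum>i<N. c i / (sn2 * d i powr alpha + sv2 i * c i))"
  \<comment> \<open>Nonnegativity keeps the limiting denominator \<open>1 + st2 * L\<close> away
    from 0, so the detection probability depends continuously on the quadratic form at its
    limit.\<close>
  have "L \<ge> 0"
    unfolding L_def using assms(4,7,8,9) by (intro sum_nonneg) (simp add: less_imp_le)
  then have pos: "1 + st2 * L > 0" using assms(5) by (simp add: add_pos_nonneg)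
  \<comment> \<open>There are finitely many index pairs, so one null set, determined by the channel
    entries alone, serves them all; outside it the argument is deterministic.\<close>
  have "AE \<omega> in P. \<forall>i\<in>{..<N}. \<forall>j\<in>{..<N}.
      (\<lambda>M. (\<Sum>m<M. cnj (h m i \<omega>) * h m j \<omega>) / of_nat M) \<longlonglongrightarrow> (if i = j then 1 else 0)"
    using gram_average_tendsto[OF assms(2,3)] by (intro AE_finite_allI) auto
  then show ?thesis unfolding L_def[symmetric]
  proof eventually_elim
    case (elim \<omega>)
    have g: "(\<lambda>M. g_fun N sn2 sv2 (chan_mat M N d alpha (\<lambda>m i. h m i \<omega>)) (a M)) \<longlonglongrightarrow> complex_of_real L"
      unfolding L_def by (rule g_fun_tendsto) (use elim assms(4,7-11) in auto)
    then have "(\<lambda>M. Re (g_fun N sn2 sv2 (chan_mat M N d alpha (\<lambda>m i. h m i \<omega>)) (a M))) \<longlonglongrightarrow> L"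
      using tendsto_Re by fastforce
    then have "(\<lambda>M. \<epsilon> powr (1 / (1 + st2 * Re (g_fun N sn2 sv2 (chan_mat M N d alpha (\<lambda>m i. h m i \<omega>)) (a M)))))
        \<longlonglongrightarrow> \<epsilon> powr (1 / (1 + st2 * L))"
      using pos assms(12) by (intro tendsto_powr tendsto_divide tendsto_add tendsto_mult tendsto_const) auto
    with g show ?case by blast
  qed
qed

end
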